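(* Let $\mathcal J=\{J_1,\dots,J_m\}$ be an arbitrary cover of $I=\{1,\dots,n\}$. For every $J\in\mathcal J$ let $W^J$ be a Wasserstein matrix for the ideal Gibbs kernel $P^J$ such that $$W^J_{i,j}=\begin{cases}\mathbb I_{[i=j]}, & i\in J^c,\\ 0, & i\in J,\ j\in I\setminus\partial J,\end{cases}\qquad W^J_{i,j}\in[0,1]\ \text{ for } i\in J,\ j\in\partial J .$$ Let $\partial=\bigcup_{J\in\mathcal J}\partial J$ and assume that there is a constant $\lambda<1$ such that $\max_{i\in J\cap\partial}\sum_{j\in\partial J}W^J_{i,j}\le\lambda$ for all $J\in\mathcal J$. Let $\mathcal P=P^{J_1}\cdots P^{J_m}$ and $\mathcal W=W^{J_m}\cdots W^{J_1}$. Let $\mu$ and $\nu$ be two probability distributions on $\mathsf X^n$ and let $\Psi$ be an arbitrary coupling of $\mu$ and $\nu$. Then, for any $k\ge1$ and any $f:\mathsf X^n\to\mathbb R$ of finite oscillation, $$|\mu\mathcal P^kf-\nu\mathcal P^kf|\le\|\mathcal W\|_\infty\,\lambda^{k-1}\,\max_{j\in I}\{\Psi(X_j\ne Z_j)\}\,\sum_{i\in I}\mathrm{osc}_i(f).$$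
   Context: Setting: $\mathsf X$ is the state space and $\mathsf Y$ the observation space of a hidden Markov model with initial distribution having density $\mu_0$, transition kernel with density $m(x,x')$ with respect to a $\sigma$-finite measure on $\mathsf X$, and observation density $g(x,y)$. Observations $y_{1:n}$ are fixed. The joint smoothing distribution $\phi$ is the probability distribution on $\mathsf X^n$ with density proportional to $\mu_0(x_1)g(x_1,y_1)\prod_{t=2}^n m(x_{t-1},x_t)g(x_t,y_t)$. Notation: $I=\{1,\dots,n\}$. For $J\subset I$: $J^c=I\setminus J$, $x_J=(x_i:i\in J)$, and $\partial J=\{t\in J^c: t+1\in J\text{ or }t-1\in J\}$. $\phi^J_x$ is (a version of) the regular conditional distribution under $\phi$ of $X_J$ given $X_{J^c}=x_{J^c}$; it depends on $x$ only through $x_{\partial J}$. The ideal Gibbs kernel updating block $J$ is $P^J(x,\mathrm dx')=\phi^J_x(\mathrm dx'_J)\,\delta_{x_{J^c}}(\mathrm dx'_{J^c})$ on $\mathsf X^n$. Kernels are composed as $(PQ)(x,\cdot)=\int P(x,\mathrm dy)Q(y,\cdot)$, and $\mu Pf=\int\mu(\mathrm dx)P(x,\mathrm dy)f(y)$. For $f:\mathsf X^n\to\mathbb R$, $\mathrm{osc}_i(f)=\sup\{|f(x)-f(y)|: x,y\in\mathsf X^n,\ x_j=y_j\ \forall j\ne i\}$, and $f$ has finite oscillation if $\sup_{x,z}|f(x)-f(z)|<\infty$. A (nonnegative) matrix $W=(W_{i,j})_{i,j\in I}$ is a Wasserstein matrix for a Markov kernel $P$ on $\mathsf X^n$ if $\mathrm{osc}_j(Pf)\le\sum_{i\in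 I}\mathrm{osc}_i(f)W_{i,j}$ for all $j\in I$ and all $f$ of finite oscillation. $\|A\|_\infty=\max_i\sum_j|a_{i,j}|$. A maximum over an empty index set is taken to be $0$. A coupling $\Psi$ of $\mu,\nu$ is a probability measure on $\mathsf X^n\times\mathsf X^n$ with marginals $\mu$ and $\nu$; $\Psi(X_j\ne Z_j)=\int\Psi(\mathrm dx,\mathrm dz)\mathbb I_{[x_j\ne z_j]}$. *)

theory Defs
  imports "HOL-Probability.Probability"
begin

section \<open>Hidden Markov models and the joint smoothing distribution\<close>

text \<open>
  The measure \<open>X\<close> is the \<open>\<sigma>\<close>-finite reference measure on the state space, \<open>Y\<close> the one on the
  observation space.
\<close>

locale hidden_markov_model = sigma_finite_measure X
  for X :: "'a measure" +
  fixes Y :: "'b measure"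
    and mu0 :: "'a \<Rightarrow> real"
    and m :: "'a \<Rightarrow> 'a \<Rightarrow> real"
    and g :: "'a \<Rightarrow> 'b \<Rightarrow> real"
  assumes mu0_measurable: "mu0 \<in> borel_measurable X"
    and mu0_nonneg: "\<And>x. x \<in> space X \<Longrightarrow> 0 \<le> mu0 x"
    and mu0_density: "(\<integral>\<^sup>+ x. ennreal (mu0 x) \<partial>X) = 1"
    and m_measurable: "(\<lambda>(x, x'). m x x') \<in> borel_measurable (X \<Otimes>\<^sub>M X)"
    and m_nonneg: "\<And>x x'. x \<in> space X \<Longrightarrow> x' \<in> space X \<Longrightarrow> 0 \<le> m x x'"
    and m_density: "\<And>x. x \<in> space X \<Longrightarrow> (\<integral>\<^sup>+ x'. ennreal (m x x') \<partial>X) = 1"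
    and g_measurable: "(\<lambda>(x, y). g x y) \<in> borel_measurable (X \<Otimes>\<^sub>M Y)"
    and g_nonneg: "\<And>x y. x \<in> space X \<Longrightarrow> y \<in> space Y \<Longrightarrow> 0 \<le> g x y"
    and g_density: "\<And>x. x \<in> space X \<Longrightarrow> (\<integral>\<^sup>+ y. ennreal (g x y) \<partial>Y) = 1"

abbreviation path_space :: "'a measure \<Rightarrow> nat \<Rightarrow> (nat \<Rightarrow> 'a) measure" where
  "path_space X n \<equiv> PiM {1..n} (\<lambda>_. X)"

definition joint_density ::
  "nat \<Rightarrow> ('a \<Rightarrow> real) \<Rightarrow> ('a \<Rightarrow> 'a \<Rightarrow> real) \<Rightarrow> ('a \<Rightarrow> 'b \<Rightarrow> real) \<Rightarrow> (nat \<Rightarrow> 'b) \<Rightarrow> (nat \<Rightarrow> 'a) \<Rightarrow> real"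
where
  "joint_density n mu0 m g y x =
     mu0 (x 1) * g (x 1) (y 1) * (\<Prod>t\<in>{2..n}. m (x (t - 1)) (x t) * g (x t) (y t))"

definition evidence ::
  "'a measure \<Rightarrow> nat \<Rightarrow> ('a \<Rightarrow> real) \<Rightarrow> ('a \<Rightarrow> 'a \<Rightarrow> real) \<Rightarrow> ('a \<Rightarrow> 'b \<Rightarrow> real) \<Rightarrow> (nat \<Rightarrow> 'b) \<Rightarrow> ennreal"
where
  "evidence X n mu0 m g y = (\<integral>\<^sup>+ x. ennreal (joint_density n mu0 m g y x) \<partial>path_space X n)"

text \<open>A probability measure only if the evidence is neither \<open>0\<close> nor \<open>\<infinity>\<close>.\<close>

definition smoothing ::
  "'a measure \<Rightarrow> nat \<Rightarrow> ('a \<Rightarrow> real) \<Rightarrow> ('a \<Rightarrow> 'a \<Rightarrow> real) \<Rightarrow> ('a \<Rightarrow> 'b \<Rightarrow> real) \<Rightarrow> (nat \<Rightarrow> 'b)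
    \<Rightarrow> (nat \<Rightarrow> 'a) measure"
where
  "smoothing X n mu0 m g y =
     density (path_space X n) (\<lambda>x. ennreal (joint_density n mu0 m g y x) / evidence X n mu0 m g y)"


section \<open>Ideal blocked Gibbs kernels\<close>

text \<open>
  For \<open>J \<subseteq> {1..n}\<close> the truncated subtraction is harmless: \<open>1 - 1 = 0\<close> never lies in \<open>J\<close>.
\<close>

definition boundary :: "nat \<Rightarrow> nat set \<Rightarrow> nat set" where
  "boundary n J = {t \<in> {1..n} - J. t + 1 \<in> J \<or> t - 1 \<in> J}"

text \<open>
  \<open>\<kappa>\<close> is a version of the regular conditional distribution of the coordinates in \<open>J\<close> given the
  remaining ones under \<open>\<phi>\<close>. It takes the whole path as argument, but only reads off the
  coordinates in \<open>\<partial>J\<close>.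
\<close>

definition block_conditional ::
  "'a measure \<Rightarrow> nat \<Rightarrow> (nat \<Rightarrow> 'a) measure \<Rightarrow> nat set \<Rightarrow> ((nat \<Rightarrow> 'a) \<Rightarrow> (nat \<Rightarrow> 'a) measure) \<Rightarrow> bool"
where
  "block_conditional X n \<phi> J \<kappa> \<longleftrightarrow>
     \<kappa> \<in> path_space X n \<rightarrow>\<^sub>M prob_algebra (PiM J (\<lambda>_. X)) \<and>
     (\<forall>x\<in>space (path_space X n). \<forall>z\<in>space (path_space X n).
        (\<forall>t\<in>boundary n J. x t = z t) \<longrightarrow> \<kappa> x = \<kappa> z) \<and>
     (\<forall>A\<in>sets (PiM J (\<lambda>_. X)). \<forall>B\<in>sets (PiM ({1..n} - J) (\<lambda>_. X)).
        emeasure \<phi> {x \<in> space (path_space X n). restrict x J \<in> A \<and> restrict x ({1..n} - J) \<in> B} =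
        (\<integral>\<^sup>+ x. indicator B (restrict x ({1..n} - J)) * emeasure (\<kappa> x) A \<partial>\<phi>))"

definition gibbs_kernel ::
  "'a measure \<Rightarrow> nat \<Rightarrow> nat set \<Rightarrow> ((nat \<Rightarrow> 'a) \<Rightarrow> (nat \<Rightarrow> 'a) measure)
    \<Rightarrow> (nat \<Rightarrow> 'a) \<Rightarrow> (nat \<Rightarrow> 'a) measure"
where
  "gibbs_kernel X n J \<kappa> x =
     distr (\<kappa> x \<Otimes>\<^sub>M return (PiM ({1..n} - J) (\<lambda>_. X)) (restrict x ({1..n} - J)))
       (path_space X n) (merge J ({1..n} - J))"


section \<open>Operations on kernels\<close>

definition kernel_comp :: "('s \<Rightarrow> 's measure) \<Rightarrow> ('s \<Rightarrow> 's measure) \<Rightarrow> 's \<Rightarrow> 's measure" where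
  "kernel_comp P Q x = P x \<bind> Q"

text \<open>\<open>kernel_prod S [P\<^sub>1, \<dots>, P\<^sub>l]\<close> is \<open>P\<^sub>1 \<cdots> P\<^sub>l\<close>; \<open>return S\<close> is the identity kernel on \<open>S\<close>.\<close>

definition kernel_prod :: "'s measure \<Rightarrow> ('s \<Rightarrow> 's measure) list \<Rightarrow> 's \<Rightarrow> 's measure" where
  "kernel_prod S Ps = foldr kernel_comp Ps (return S)"

definition kernel_power :: "'s measure \<Rightarrow> ('s \<Rightarrow> 's measure) \<Rightarrow> nat \<Rightarrow> 's \<Rightarrow> 's measure" where
  "kernel_power S P k = kernel_prod S (replicate k P)"

definition kernel_apply :: "('s \<Rightarrow> 's measure) \<Rightarrow> ('s \<Rightarrow> real) \<Rightarrow> 's \<Rightarrow> real" where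
  "kernel_apply P f x = (\<integral>z. f z \<partial>P x)"


section \<open>Oscillations, Wasserstein matrices and couplings\<close>

text \<open>
  The suprema are taken over a bounded set whenever \<open>f\<close> has finite oscillation. As elements of
  the path space, \<open>x\<close> and \<open>z\<close> automatically agree outside \<open>{1..n}\<close>.
\<close>

definition osc :: "'a measure \<Rightarrow> nat \<Rightarrow> nat \<Rightarrow> ((nat \<Rightarrow> 'a) \<Rightarrow> real) \<Rightarrow> real" where
  "osc X n i f = Sup {\<bar>f x - f z\<bar> | x z.
     x \<in> space (path_space X n) \<and> z \<in> space (path_space X n) \<and> (\<forall>j\<in>{1..n} - {i}. x j = z j)}"

definition finite_oscillation :: "'s measure \<Rightarrow> ('s \<Rightarrow> real) \<Rightarrow> bool" where
  "finite_oscillation S f \<longleftrightarrow> bdd_above {\<bar>f x - f z\<bar> | x z. x \<in> space S \<and> z \<in> space S}"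

definition wasserstein_matrix ::
  "'a measure \<Rightarrow> nat \<Rightarrow> ((nat \<Rightarrow> 'a) \<Rightarrow> (nat \<Rightarrow> 'a) measure) \<Rightarrow> (nat \<Rightarrow> nat \<Rightarrow> real) \<Rightarrow> bool"
where
  "wasserstein_matrix X n P W \<longleftrightarrow>
     (\<forall>i\<in>{1..n}. \<forall>j\<in>{1..n}. 0 \<le> W i j) \<and>
     (\<forall>f j. f \<in> borel_measurable (path_space X n) \<longrightarrow> finite_oscillation (path_space X n) f \<longrightarrow>
        j \<in> {1..n} \<longrightarrow> osc X n j (kernel_apply P f) \<le> (\<Sum>i\<in>{1..n}. osc X n i f * W i j))"

definition coupling :: "'s measure \<Rightarrow> 's measure \<Rightarrow> 's measure \<Rightarrow> ('s \<times> 's) measure \<Rightarrow> bool" where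
  "coupling S \<mu> \<nu> \<Psi> \<longleftrightarrow>
     \<Psi> \<in> space (prob_algebra (S \<Otimes>\<^sub>M S)) \<and> distr \<Psi> S fst = \<mu> \<and> distr \<Psi> S snd = \<nu>"


section \<open>Matrices indexed by \<open>{1..n}\<close>\<close>

text \<open>
  Only the entries with both indices in \<open>{1..n}\<close> are meaningful. Maxima over an empty index set
  are \<open>0\<close>.
\<close>

definition max_over :: "'i set \<Rightarrow> ('i \<Rightarrow> real) \<Rightarrow> real" where
  "max_over A h = (if A = {} then 0 else Max (h ` A))"

definition mat_mult ::
  "nat \<Rightarrow> (nat \<Rightarrow> nat \<Rightarrow> real) \<Rightarrow> (nat \<Rightarrow> nat \<Rightarrow> real) \<Rightarrow> nat \<Rightarrow> nat \<Rightarrow> real" where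
  "mat_mult n A B i j = (\<Sum>l\<in>{1..n}. A i l * B l j)"

definition mat_prod :: "nat \<Rightarrow> (nat \<Rightarrow> nat \<Rightarrow> real) list \<Rightarrow> nat \<Rightarrow> nat \<Rightarrow> real" where
  "mat_prod n As = foldr (mat_mult n) As (\<lambda>i j. if i = j then 1 else 0)"

definition mat_norm_inf :: "nat \<Rightarrow> (nat \<Rightarrow> nat \<Rightarrow> real) \<Rightarrow> real" where
  "mat_norm_inf n A = max_over {1..n} (\<lambda>i. \<Sum>j\<in>{1..n}. \<bar>A i j\<bar>)"

end

theory Submission
  imports Defs
begin

text \<open>
  Wasserstein matrices compose in the order opposite to the kernels: two applications of the
  defining inequality give \<open>osc\<^sub>j (P (Q f)) \<le> \<Sum>\<^sub>i osc\<^sub>i (Q f) A\<^sub>i\<^sub>j \<le> \<Sum>\<^sub>l osc\<^sub>l f (B A)\<^sub>l\<^sub>j\<close> if \<open>A\<close> belongs to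
  \<open>P\<close> and \<open>B\<close> to \<open>Q\<close>. Hence \<open>\<W> = W\<^sup>J\<^sub>m \<cdots> W\<^sup>J\<^sub>1\<close> is a Wasserstein matrix for one
  sweep, and \<open>\<W>\<^sup>k\<close> is one for \<open>k\<close> sweeps (\<open>wasserstein_matrix_kernel_prod\<close>). Changing the coordinates
  of \<open>x\<close> one at a time into those of \<open>z\<close> bounds \<open>\<bar>h x - h z\<bar>\<close> by the sum of \<open>osc\<^sub>j h\<close> over the
  coordinates in which the two differ; integrating this against the coupling \<open>\<Psi>\<close> with
  \<open>h\<close> the image of \<open>f\<close> under \<open>k\<close> sweeps gives
  \<open>\<Sum>\<^sub>i osc\<^sub>i f \<Sum>\<^sub>j (\<W>\<^sup>k)\<^sub>i\<^sub>j \<Psi> (X\<^sub>j \<noteq> Z\<^sub>j)\<close> as a bound for the difference of the two expectations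
  (\<open>coupling_integral_bound\<close>).

  What remains is a bound on the row sums of \<open>\<W>\<^sup>k\<close>, and here the boundary set \<open>D\<close> enters. Let a
  matrix \<open>W\<^sup>J\<close> act on vectors indexed by the sites \<open>1, \<dots>, n\<close>: it keeps the values
  outside \<open>J\<close> and replaces those in \<open>J\<close> by weighted sums of the values on \<open>\<partial>J \<subseteq> D\<close>. Because
  the blocks cover all sites, every value is replaced at least once during a sweep. This has two
  consequences. The result of a sweep depends only on the values on \<open>D\<close> that it starts from, which
  gives \<open>\<W> u \<le> c \<W> 1\<close> as soon as \<open>u \<le> c\<close> on \<open>D\<close> (\<open>sweep_le_scaled_ones\<close>). And if the values on \<open>D\<close>
  are at most \<open>c\<close>, they are at most \<open>\<lambda> c\<close> after the sweep, since each of them has been replaced by a sum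
  with total weight at most \<open>\<lambda>\<close> (\<open>sweep_contracts_boundary\<close>). So \<open>\<W>\<^sup>k\<^sup>-\<^sup>1 1 \<le> \<lambda>\<^sup>k\<^sup>-\<^sup>1\<close> on \<open>D\<close>, and
  therefore \<open>\<W>\<^sup>k 1 \<le> \<lambda>\<^sup>k\<^sup>-\<^sup>1 \<W> 1\<close>.
  Only one of the \<open>k\<close> sweeps is spent on the sites outside \<open>D\<close>, and it costs the factor \<open>\<parallel>\<W>\<parallel>\<^sub>\<infinity>\<close>.
\<close>


section \<open>Matrices acting on vectors\<close>

definition mat_vec :: "nat \<Rightarrow> (nat \<Rightarrow> nat \<Rightarrow> real) \<Rightarrow> (nat \<Rightarrow> real) \<Rightarrow> nat \<Rightarrow> real" where
  "mat_vec n A v i = (\<Sum>l\<in>{1..n}. A i l * v l)"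

lemma mat_vec_mult: "mat_vec n (mat_mult n A B) v = mat_vec n A (mat_vec n B v)"
proof
  fix i
  have "mat_vec n (mat_mult n A B) v i = (\<Sum>j\<in>{1..n}. \<Sum>l\<in>{1..n}. A i l * B l j * v j)"
    by (simp add: mat_vec_def mat_mult_def sum_distrib_right)
  also have "\<dots> = (\<Sum>l\<in>{1..n}. \<Sum>j\<in>{1..n}. A i l * B l j * v j)"
    by (rule sum.swap)
  also have "\<dots> = mat_vec n A (mat_vec n B v) i"
    by (simp add: mat_vec_def sum_distrib_left mult.assoc)
  finally show "mat_vec n (mat_mult n A B) v i = mat_vec n A (mat_vec n B v) i" .
qed

lemma mat_vec_prod_Nil: "i \<in> {1..n} \<Longrightarrow> mat_vec n (mat_prod n []) v i = v i"
  by (simp add: mat_vec_def mat_prod_def mult_delta_left)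

lemma mat_prod_Cons: "mat_prod n (A # As) = mat_mult n A (mat_prod n As)"
  by (simp add: mat_prod_def)

lemma mat_mult_identity:
  assumes "i \<in> {1..n}" "j \<in> {1..n}"
  shows "mat_mult n A (mat_prod n []) i j = A i j" "mat_mult n (mat_prod n []) A i j = A i j"
  using assms by (simp_all add: mat_mult_def mat_prod_def mult_delta_left mult_delta_right)

lemma mat_mult_assoc: "mat_mult n (mat_mult n A B) C i j = mat_mult n A (mat_mult n B C) i j"
  using fun_cong[OF mat_vec_mult[of n A B "\<lambda>l. C l j"], of i] by (simp add: mat_mult_def mat_vec_def)

text \<open>The two sides may differ outside \<open>{1..n}\<close>, where the identity matrix is not neutral.\<close>

lemma mat_prod_snoc:
  assumes "i \<in> {1..n}" "j \<in> {1..n}"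
  shows "mat_prod n (As @ [A]) i j = mat_mult n (mat_prod n As) A i j"
  using assms
proof (induction As arbitrary: i)
  case Nil
  then show ?case
    by (simp add: mat_prod_Cons mat_mult_identity del: One_nat_def)
next
  case (Cons B As)
  have "mat_prod n ((B # As) @ [A]) i j = (\<Sum>l\<in>{1..n}. B i l * mat_prod n (As @ [A]) l j)"
    by (simp add: mat_prod_Cons mat_mult_def)
  also have "\<dots> = (\<Sum>l\<in>{1..n}. B i l * mat_mult n (mat_prod n As) A l j)"
    using Cons.IH Cons.prems(2) by (intro sum.cong refl) simp
  also have "\<dots> = mat_mult n B (mat_mult n (mat_prod n As) A) i j"
    by (simp add: mat_mult_def)
  finally show ?case
    by (simp add: mat_prod_Cons mat_mult_assoc)
qed

lemma max_over_ge: "finite A \<Longrightarrow> i \<in> A \<Longrightarrow> h i \<le> max_over A h"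
  by (auto simp: max_over_def)

lemma row_sum_le_norm:
  assumes "i \<in> {1..n}"
  shows "mat_vec n A (\<lambda>_. 1) i \<le> mat_norm_inf n A"
proof -
  have "mat_vec n A (\<lambda>_. 1) i \<le> (\<Sum>j\<in>{1..n}. \<bar>A i j\<bar>)"
    unfolding mat_vec_def by (intro sum_mono) simp
  also have "\<dots> \<le> mat_norm_inf n A"
    unfolding mat_norm_inf_def using assms by (intro max_over_ge) auto
  finally show ?thesis .
qed


section \<open>Row sums of iterated sweeps\<close>

locale block_matrices =
  fixes n :: nat and Js :: "nat set list" and W :: "nat set \<Rightarrow> nat \<Rightarrow> nat \<Rightarrow> real"
    and D :: "nat set" and lam :: real
  assumes cover: "\<Union>(set Js) = {1..n}"
    and boundary_subset: "J \<in> set Js \<Longrightarrow> boundary n J \<subseteq> D"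
    and D_subset: "D \<subseteq> {1..n}"
    and outside: "J \<in> set Js \<Longrightarrow> i \<in> {1..n} - J \<Longrightarrow> j \<in> {1..n} \<Longrightarrow> W J i j = (if i = j then 1 else 0)"
    and inside: "J \<in> set Js \<Longrightarrow> i \<in> J \<Longrightarrow> j \<in> {1..n} - boundary n J \<Longrightarrow> W J i j = 0"
    and nonneg: "J \<in> set Js \<Longrightarrow> i \<in> J \<Longrightarrow> j \<in> boundary n J \<Longrightarrow> 0 \<le> W J i j"
    and boundary_rows: "J \<in> set Js \<Longrightarrow> i \<in> J \<inter> D \<Longrightarrow> (\<Sum>j\<in>boundary n J. W J i j) \<le> lam"
begin

lemma update_outside:
  assumes "J \<in> set Js" "i \<in> {1..n} - J"
  shows "mat_vec n (W J) v i = v i"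
proof -
  have "mat_vec n (W J) v i = (\<Sum>l\<in>{1..n}. if i = l then v l else 0)"
    unfolding mat_vec_def using outside[OF assms] by (intro sum.cong) auto
  then show ?thesis
    using assms(2) by simp
qed

lemma update_inside:
  assumes "J \<in> set Js" "i \<in> J"
  shows "mat_vec n (W J) v i = (\<Sum>j\<in>boundary n J. W J i j * v j)"
  unfolding mat_vec_def
  using inside[OF assms] by (intro sum.mono_neutral_right) (auto simp: boundary_def)

text \<open>The reversal of the list makes the matrix of the first block act first.\<close>

abbreviation sweep :: "nat set list \<Rightarrow> nat \<Rightarrow> nat \<Rightarrow> real" where
  "sweep Ks \<equiv> mat_prod n (map W (rev Ks))"

lemma sweep_snoc: "mat_vec n (sweep (Ks @ [J])) v = mat_vec n (W J) (mat_vec n (sweep Ks) v)"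
  by (simp add: mat_prod_Cons mat_vec_mult)

text \<open>
  In the middle of a sweep only the values on \<open>D\<close> and those in blocks already visited are known to be
  determined by the initial values on \<open>D\<close>. The updated sites of the next block read from \<open>D\<close> alone,
  and monotonicity of a nonnegative weighted sum carries the comparison over to them.
\<close>

lemma partial_sweep_le_scaled_ones:
  assumes u: "\<And>i. i \<in> D \<Longrightarrow> u i \<le> c"
    and "set Ks \<subseteq> set Js" "i \<in> D \<union> \<Union>(set Ks)"
  shows "mat_vec n (sweep Ks) u i \<le> c * mat_vec n (sweep Ks) (\<lambda>_. 1) i"
  using assms(2,3)
proof (induction Ks arbitrary: i rule: rev_induct)
  case Nil
  then show ?case
    using u D_subset by (auto simp: mat_vec_prod_Nil subset_iff simp del: One_nat_def)
next
  case (snoc J Ks)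
  let ?u = "mat_vec n (sweep Ks) u" and ?e = "mat_vec n (sweep Ks) (\<lambda>_. 1)"
  have J: "J \<in> set Js" and Ks: "set Ks \<subseteq> set Js"
    using snoc.prems by auto
  show ?case
  proof (cases "i \<in> J")
    case True
    have "(\<Sum>j\<in>boundary n J. W J i j * ?u j) \<le> (\<Sum>j\<in>boundary n J. W J i j * (c * ?e j))"
      using boundary_subset[OF J] nonneg[OF J True] snoc.IH[OF Ks]
      by (intro sum_mono mult_left_mono) auto
    then show ?thesis
      unfolding sweep_snoc by (simp add: update_inside[OF J True] sum_distrib_left mult.left_commute)
  next
    case False
    then have i: "i \<in> D \<union> \<Union>(set Ks)"
      using snoc.prems by auto
    have "i \<in> {1..n} - J"
      using i False D_subset cover Ks by blast
    then show ?thesis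
      unfolding sweep_snoc using update_outside[OF J] snoc.IH[OF Ks i] by simp
  qed
qed

corollary sweep_le_scaled_ones:
  assumes "\<And>i. i \<in> D \<Longrightarrow> u i \<le> c" "i \<in> {1..n}"
  shows "mat_vec n (sweep Js) u i \<le> c * mat_vec n (sweep Js) (\<lambda>_. 1) i"
  using partial_sweep_le_scaled_ones[of u c Js i] assms cover by auto

text \<open>
  In the middle of a sweep the sites of \<open>D\<close> not visited yet still have the bound \<open>c\<close>, and \<open>\<lambda> c \<le> c\<close>.
  So every site of \<open>D\<close> stays below \<open>c\<close>, and a visit brings it below \<open>\<lambda> c\<close>.
\<close>

lemma partial_sweep_contracts_boundary:
  assumes v: "\<And>i. i \<in> D \<Longrightarrow> v i \<le> c" and "0 \<le> c" "lam \<le> 1"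
    and "set Ks \<subseteq> set Js" "i \<in> D"
  shows "mat_vec n (sweep Ks) v i \<le> (if i \<in> \<Union>(set Ks) then lam * c else c)"
  using assms(4,5)
proof (induction Ks arbitrary: i rule: rev_induct)
  case Nil
  then show ?case
    using v D_subset by (auto simp: mat_vec_prod_Nil subset_iff simp del: One_nat_def)
next
  case (snoc J Ks)
  let ?v = "mat_vec n (sweep Ks) v"
  have J: "J \<in> set Js" and Ks: "set Ks \<subseteq> set Js"
    using snoc.prems by auto
  have lam_c: "lam * c \<le> c"
    using mult_right_mono[OF \<open>lam \<le> 1\<close> \<open>0 \<le> c\<close>] by simp
  have v_le: "?v j \<le> c" if "j \<in> D" for j
    using snoc.IH[OF Ks that] lam_c by (simp split: if_splits)
  show ?case
  proof (cases "i \<in> J")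
    case True
    have "(\<Sum>j\<in>boundary n J. W J i j * ?v j) \<le> (\<Sum>j\<in>boundary n J. W J i j * c)"
      using boundary_subset[OF J] nonneg[OF J True] v_le by (intro sum_mono mult_left_mono) auto
    also have "\<dots> \<le> lam * c"
      unfolding sum_distrib_right[symmetric]
      using boundary_rows[OF J] True snoc.prems \<open>0 \<le> c\<close> by (intro mult_right_mono) auto
    finally show ?thesis
      unfolding sweep_snoc using True by (simp add: update_inside[OF J True])
  next
    case False
    then have "i \<in> {1..n} - J"
      using snoc.prems D_subset by auto
    then show ?thesis
      unfolding sweep_snoc using update_outside[OF J] snoc.IH[OF Ks snoc.prems(2)] False by simp
  qed
qed

corollary sweep_contracts_boundary:
  assumes "\<And>i. i \<in> D \<Longrightarrow> v i \<le> c" "0 \<le> c" "lam \<le> 1" "i \<in> D"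
  shows "mat_vec n (sweep Js) v i \<le> lam * c"
  using partial_sweep_contracts_boundary[of v c Js i] assms cover D_subset
  by auto

lemma iterated_sweep_boundary_row_sum:
  assumes "0 \<le> lam" "lam \<le> 1" "i \<in> D"
  shows "mat_vec n (mat_prod n (replicate k (sweep Js))) (\<lambda>_. 1) i \<le> lam ^ k"
  using assms(3)
proof (induction k arbitrary: i)
  case 0
  then show ?case
    using D_subset by (auto simp: mat_vec_prod_Nil subset_iff simp del: One_nat_def)
next
  case (Suc k)
  have "mat_vec n (sweep Js) (mat_vec n (mat_prod n (replicate k (sweep Js))) (\<lambda>_. 1)) i \<le> lam * lam ^ k"
    by (rule sweep_contracts_boundary) (use Suc assms in auto)
  then show ?case
    by (simp add: mat_prod_Cons mat_vec_mult)
qed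

lemma iterated_sweep_row_sum:
  assumes "0 \<le> lam" "lam \<le> 1" "i \<in> {1..n}"
  shows "mat_vec n (mat_prod n (replicate (Suc k) (sweep Js))) (\<lambda>_. 1) i
    \<le> mat_norm_inf n (sweep Js) * lam ^ k"
proof -
  have "mat_vec n (mat_prod n (replicate (Suc k) (sweep Js))) (\<lambda>_. 1) i
      \<le> lam ^ k * mat_vec n (sweep Js) (\<lambda>_. 1) i"
    unfolding replicate_Suc mat_prod_Cons mat_vec_mult
    by (rule sweep_le_scaled_ones) (use iterated_sweep_boundary_row_sum assms in auto)
  also have "\<dots> \<le> lam ^ k * mat_norm_inf n (sweep Js)"
    using row_sum_le_norm[OF assms(3)] assms(1) by (intro mult_left_mono) auto
  finally show ?thesis
    by (simp add: mult.commute)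
qed

end


section \<open>Markov kernels acting on functions of finite oscillation\<close>

lemma finite_oscillation_iff_bounded:
  "finite_oscillation S f \<longleftrightarrow> (\<exists>B. \<forall>x\<in>space S. \<bar>f x\<bar> \<le> B)"
proof
  assume "finite_oscillation S f"
  then obtain C where C: "\<And>x z. x \<in> space S \<Longrightarrow> z \<in> space S \<Longrightarrow> \<bar>f x - f z\<bar> \<le> C"
    unfolding finite_oscillation_def bdd_above_def by blast
  show "\<exists>B. \<forall>x\<in>space S. \<bar>f x\<bar> \<le> B"
  proof (cases "space S = {}")
    case False
    then obtain z where "z \<in> space S"
      by blast
    then have "\<forall>x\<in>space S. \<bar>f x\<bar> \<le> C + \<bar>f z\<bar>"
      using C by fastforce
    then show ?thesis
      by blast
  qed simp
next
  assume "\<exists>B. \<forall>x\<in>space S. \<bar>f x\<bar> \<le> B"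
  then obtain B where B: "\<And>x. x \<in> space S \<Longrightarrow> \<bar>f x\<bar> \<le> B"
    by blast
  have "\<bar>f x - f z\<bar> \<le> 2 * B" if "x \<in> space S" "z \<in> space S" for x z
    using B[OF that(1)] B[OF that(2)] by linarith
  then have "d \<le> 2 * B" if "d \<in> {\<bar>f x - f z\<bar> | x z. x \<in> space S \<and> z \<in> space S}" for d
    using that by blast
  then show "finite_oscillation S f"
    unfolding finite_oscillation_def by (rule bdd_aboveI)
qed

lemma kernel_value:
  assumes "P \<in> S \<rightarrow>\<^sub>M prob_algebra S" "x \<in> space S"
  shows "prob_space (P x)" "sets (P x) = sets S" "space (P x) = space S"
proof -
  have "P x \<in> space (prob_algebra S)"
    using measurable_space[OF assms] .
  then show "prob_space (P x)" "sets (P x) = sets S" "space (P x) = space S"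
    by (auto simp: space_prob_algebra dest: sets_eq_imp_space_eq)
qed

lemma measurable_kernel_apply:
  assumes P: "P \<in> S \<rightarrow>\<^sub>M prob_algebra S" and f: "f \<in> borel_measurable S"
  shows "kernel_apply P f \<in> borel_measurable S"
  unfolding kernel_apply_def
  using measurable_compose[OF measurable_prob_algebraD[OF P] integral_measurable_subprob_algebra[OF f]] .

lemma finite_oscillation_kernel_apply:
  assumes P: "P \<in> S \<rightarrow>\<^sub>M prob_algebra S" and f: "f \<in> borel_measurable S" "finite_oscillation S f"
  shows "finite_oscillation S (kernel_apply P f)"
proof -
  obtain B where B: "\<forall>x\<in>space S. \<bar>f x\<bar> \<le> B"
    using f(2) unfolding finite_oscillation_iff_bounded by blast
  have "\<bar>kernel_apply P f x\<bar> \<le> B" if x: "x \<in> space S" for x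
  proof -
    interpret prob_space "P x"
      by (rule kernel_value[OF P x])
    have f_P: "f \<in> borel_measurable (P x)"
      using f(1) unfolding measurable_cong_sets[OF kernel_value(2)[OF P x] refl] .
    have B_P: "AE z in P x. norm (f z) \<le> B"
      using B unfolding kernel_value(3)[OF P x, symmetric] by (intro AE_I2) simp
    have "\<bar>kernel_apply P f x\<bar> \<le> (\<integral>z. B \<partial>P x)"
      unfolding kernel_apply_def
      using integrable_const_bound[OF B_P f_P] B unfolding kernel_value(3)[OF P x, symmetric]
      by (intro order_trans[OF integral_abs_bound integral_mono]) simp_all
    then show ?thesis
      by (simp add: prob_space)
  qed
  then show ?thesis
    unfolding finite_oscillation_iff_bounded by blast
qed

lemma measurable_kernel_comp:
  assumes "P \<in> S \<rightarrow>\<^sub>M prob_algebra S" "Q \<in> S \<rightarrow>\<^sub>M prob_algebra S"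
  shows "kernel_comp P Q \<in> S \<rightarrow>\<^sub>M prob_algebra S"
  unfolding kernel_comp_def[abs_def] using assms by (rule measurable_bind_prob_space)

lemma kernel_apply_comp:
  assumes P: "P \<in> S \<rightarrow>\<^sub>M prob_algebra S" and Q: "Q \<in> S \<rightarrow>\<^sub>M prob_algebra S"
    and f: "f \<in> borel_measurable S" "finite_oscillation S f" and x: "x \<in> space S"
  shows "kernel_apply (kernel_comp P Q) f x = kernel_apply P (kernel_apply Q f) x"
proof -
  obtain B where B: "\<forall>x\<in>space S. \<bar>f x\<bar> \<le> B"
    using f(2) unfolding finite_oscillation_iff_bounded by blast
  interpret prob_space "P x"
    by (rule kernel_value[OF P x])
  have "Q \<in> P x \<rightarrow>\<^sub>M subprob_algebra S"
    using measurable_prob_algebraD[OF Q]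
    unfolding measurable_cong_sets[OF kernel_value(2)[OF P x] refl] .
  moreover have "AE z in P x. emeasure (Q z) (space (Q z)) \<le> ennreal 1"
    using kernel_value(1)[OF Q] unfolding kernel_value(3)[OF P x, symmetric]
    by (intro AE_I2) (simp add: prob_space.emeasure_space_1)
  ultimately show ?thesis
    unfolding kernel_apply_def kernel_comp_def
    using B by (intro integral_bind[OF f(1), where B = B and B' = 1]) (auto intro: finite_measure_axioms)
qed

lemma kernel_apply_return:
  "f \<in> borel_measurable S \<Longrightarrow> x \<in> space S \<Longrightarrow> kernel_apply (return S) f x = f x"
  by (simp add: kernel_apply_def integral_return)

lemma measurable_gibbs_kernel:
  assumes J: "J \<subseteq> {1..n}" and \<kappa>: "\<kappa> \<in> path_space X n \<rightarrow>\<^sub>M prob_algebra (PiM J (\<lambda>_. X))"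
  shows "gibbs_kernel X n J \<kappa> \<in> path_space X n \<rightarrow>\<^sub>M prob_algebra (path_space X n)"
proof -
  let ?R = "PiM ({1..n} - J) (\<lambda>_. X)"
  have "(\<lambda>x. return ?R (restrict x ({1..n} - J))) \<in> path_space X n \<rightarrow>\<^sub>M prob_algebra ?R"
    by (rule measurable_compose[OF measurable_restrict_subset measurable_return_prob_space]) auto
  note pair = measurable_pair_prob[OF \<kappa> this]
  have "J \<union> ({1..n} - J) = {1..n}"
    using J by blast
  then have merge: "merge J ({1..n} - J) \<in> PiM J (\<lambda>_. X) \<Otimes>\<^sub>M ?R \<rightarrow>\<^sub>M path_space X n"
    using measurable_merge[of J "{1..n} - J" "\<lambda>_. X"] by simp
  show ?thesis
    unfolding gibbs_kernel_def[abs_def]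
    by (rule measurable_compose[OF pair measurable_distr_prob_space[OF merge]])
qed


section \<open>Composition of Wasserstein matrices\<close>

lemma wasserstein_matrixD:
  assumes "wasserstein_matrix X n P W"
  shows "i \<in> {1..n} \<Longrightarrow> j \<in> {1..n} \<Longrightarrow> 0 \<le> W i j"
    and "f \<in> borel_measurable (path_space X n) \<Longrightarrow> finite_oscillation (path_space X n) f \<Longrightarrow>
      j \<in> {1..n} \<Longrightarrow> osc X n j (kernel_apply P f) \<le> (\<Sum>i\<in>{1..n}. osc X n i f * W i j)"
  using assms unfolding wasserstein_matrix_def by blast+

lemma wasserstein_matrix_cong:
  assumes "wasserstein_matrix X n P A" "\<And>i j. i \<in> {1..n} \<Longrightarrow> j \<in> {1..n} \<Longrightarrow> A i j = B i j"
  shows "wasserstein_matrix X n P B"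
proof -
  have "(\<Sum>i\<in>{1..n}. osc X n i f * A i j) = (\<Sum>i\<in>{1..n}. osc X n i f * B i j)" if "j \<in> {1..n}" for f j
    using assms(2)[OF _ that] by (intro sum.cong) auto
  then show ?thesis
    using assms unfolding wasserstein_matrix_def by simp
qed

lemma osc_cong:
  assumes "\<And>x. x \<in> space (path_space X n) \<Longrightarrow> f x = h x"
  shows "osc X n i f = osc X n i h"
  unfolding osc_def
  by (rule arg_cong[where f = Sup]) (use assms in \<open>auto; metis\<close>)

lemma wasserstein_matrix_return:
  "wasserstein_matrix X n (return (path_space X n)) (mat_prod n [])"
proof -
  have "osc X n j (kernel_apply (return (path_space X n)) f) = osc X n j f"
    if "f \<in> borel_measurable (path_space X n)" for f j
    using kernel_apply_return[OF that] by (rule osc_cong)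
  then show ?thesis
    unfolding wasserstein_matrix_def mat_prod_def
    by (auto simp: mult_delta_right)
qed

text \<open>
  On functions \<open>Q\<close> acts before \<open>P\<close>, which is why the matrices appear in the opposite order: \<open>A\<close> reduces
  the oscillations of \<open>P (Q f)\<close> to those of \<open>Q f\<close>, and \<open>B\<close> reduces these to the oscillations of \<open>f\<close>.
  The two bounds can be chained because \<open>A\<close> is nonnegative.
\<close>

lemma wasserstein_matrix_kernel_comp:
  assumes P: "P \<in> path_space X n \<rightarrow>\<^sub>M prob_algebra (path_space X n)"
    and Q: "Q \<in> path_space X n \<rightarrow>\<^sub>M prob_algebra (path_space X n)"
    and A: "wasserstein_matrix X n P A" and B: "wasserstein_matrix X n Q B"
  shows "wasserstein_matrix X n (kernel_comp P Q) (mat_mult n B A)"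
  unfolding wasserstein_matrix_def
proof (intro conjI ballI allI impI)
  fix i j assume "i \<in> {1..n}" "j \<in> {1..n}"
  then show "0 \<le> mat_mult n B A i j"
    unfolding mat_mult_def using wasserstein_matrixD(1)[OF A] wasserstein_matrixD(1)[OF B]
    by (intro sum_nonneg mult_nonneg_nonneg) auto
next
  fix f j
  assume f: "f \<in> borel_measurable (path_space X n)" "finite_oscillation (path_space X n) f"
    and j: "j \<in> {1..n}"
  have "osc X n j (kernel_apply (kernel_comp P Q) f) = osc X n j (kernel_apply P (kernel_apply Q f))"
    using kernel_apply_comp[OF P Q f] by (rule osc_cong)
  also have "\<dots> \<le> (\<Sum>i\<in>{1..n}. osc X n i (kernel_apply Q f) * A i j)"
    by (intro wasserstein_matrixD(2)[OF A] measurable_kernel_apply finite_oscillation_kernel_apply P Q f j)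
  also have "\<dots> \<le> (\<Sum>i\<in>{1..n}. (\<Sum>l\<in>{1..n}. osc X n l f * B l i) * A i j)"
    using wasserstein_matrixD(1)[OF A _ j] wasserstein_matrixD(2)[OF B f]
    by (intro sum_mono mult_right_mono) auto
  also have "\<dots> = (\<Sum>i\<in>{1..n}. \<Sum>l\<in>{1..n}. osc X n l f * (B l i * A i j))"
    by (simp add: sum_distrib_right mult.assoc)
  also have "\<dots> = (\<Sum>l\<in>{1..n}. \<Sum>i\<in>{1..n}. osc X n l f * (B l i * A i j))"
    by (rule sum.swap)
  also have "\<dots> = (\<Sum>l\<in>{1..n}. osc X n l f * mat_mult n B A l j)"
    by (simp add: mat_mult_def sum_distrib_left)
  finally show "osc X n j (kernel_apply (kernel_comp P Q) f)
      \<le> (\<Sum>i\<in>{1..n}. osc X n i f * mat_mult n B A i j)" .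
qed

lemma wasserstein_matrix_kernel_prod:
  assumes "list_all2 (\<lambda>P A. P \<in> path_space X n \<rightarrow>\<^sub>M prob_algebra (path_space X n)
    \<and> wasserstein_matrix X n P A) Ps As"
  shows "kernel_prod (path_space X n) Ps \<in> path_space X n \<rightarrow>\<^sub>M prob_algebra (path_space X n)"
    and "wasserstein_matrix X n (kernel_prod (path_space X n) Ps) (mat_prod n (rev As))"
proof -
  let ?S = "path_space X n"
  have "kernel_prod ?S Ps \<in> ?S \<rightarrow>\<^sub>M prob_algebra ?S
      \<and> wasserstein_matrix X n (kernel_prod ?S Ps) (mat_prod n (rev As))"
    using assms
  proof (induction rule: list_all2_induct)
    case Nil
    show ?case
      using wasserstein_matrix_return[of X n] by (simp add: kernel_prod_def)
  next
    case (Cons P Ps A As)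
    have prod: "kernel_prod ?S (P # Ps) = kernel_comp P (kernel_prod ?S Ps)"
      by (simp add: kernel_prod_def)
    have "wasserstein_matrix X n (kernel_comp P (kernel_prod ?S Ps)) (mat_mult n (mat_prod n (rev As)) A)"
      using Cons by (intro wasserstein_matrix_kernel_comp) auto
    then have "wasserstein_matrix X n (kernel_prod ?S (P # Ps)) (mat_prod n (rev (A # As)))"
      unfolding prod by (rule wasserstein_matrix_cong) (simp add: mat_prod_snoc del: One_nat_def)
    moreover have "kernel_prod ?S (P # Ps) \<in> ?S \<rightarrow>\<^sub>M prob_algebra ?S"
      unfolding prod using Cons by (intro measurable_kernel_comp) auto
    ultimately show ?case
      by blast
  qed
  then show "kernel_prod ?S Ps \<in> ?S \<rightarrow>\<^sub>M prob_algebra ?S"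
    and "wasserstein_matrix X n (kernel_prod ?S Ps) (mat_prod n (rev As))"
    by auto
qed


section \<open>Comparison of expectations through a coupling\<close>

lemma abs_diff_le_osc:
  assumes h: "finite_oscillation (path_space X n) h"
    and "x \<in> space (path_space X n)" "z \<in> space (path_space X n)"
    and "\<And>j. j \<in> {1..n} - {i} \<Longrightarrow> x j = z j"
  shows "\<bar>h x - h z\<bar> \<le> osc X n i h"
  unfolding osc_def
proof (rule cSup_upper)
  show "bdd_above {\<bar>h x - h z\<bar> | x z. x \<in> space (path_space X n) \<and> z \<in> space (path_space X n)
      \<and> (\<forall>j\<in>{1..n} - {i}. x j = z j)}"
    using h unfolding finite_oscillation_def by (rule bdd_above_mono) blast
qed (use assms in blast)

lemma osc_nonneg:
  assumes "finite_oscillation (path_space X n) h" "space (path_space X n) \<noteq> {}"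
  shows "0 \<le> osc X n i h"
  using assms abs_diff_le_osc[OF assms(1)] by fastforce

text \<open>
  The hybrid path \<open>w k\<close> has the first \<open>k\<close> coordinates of \<open>z\<close> and the remaining ones of \<open>x\<close>, so that
  consecutive hybrids differ at most in a single coordinate, and not at all where \<open>x\<close> and \<open>z\<close> agree.
\<close>

lemma abs_diff_le_sum_osc:
  assumes h: "finite_oscillation (path_space X n) h"
    and x: "x \<in> space (path_space X n)" and z: "z \<in> space (path_space X n)"
  shows "\<bar>h x - h z\<bar> \<le> (\<Sum>i\<in>{1..n}. osc X n i h * indicator {i. x i \<noteq> z i} i)"
proof -
  define w where "w k i = (if i \<le> k then z i else x i)" for k i
  \<comment> \<open>The paths start at time \<open>1\<close>; at \<open>0\<close> both have the default value, which makes \<open>w 0\<close> equal to \<open>x\<close>.\<close>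
  have x_0: "x 0 = undefined" and z_0: "z 0 = undefined"
    using x z by (auto simp: space_PiM PiE_def extensional_def)
  have w: "w k \<in> space (path_space X n)" for k
    using x z by (auto simp: w_def space_PiM PiE_iff extensional_def)
  have w_0: "w 0 = x"
    using x_0 z_0 by (auto simp: w_def)
  have w_n: "w n = z"
    using x z by (auto simp: w_def space_PiM PiE_def extensional_def fun_eq_iff)
  have "\<bar>h (w 0) - h (w k)\<bar> \<le> (\<Sum>i\<in>{1..k}. osc X n i h * indicator {i. x i \<noteq> z i} i)" for k
  proof (induction k)
    case (Suc k)
    have "\<bar>h (w k) - h (w (Suc k))\<bar> \<le> osc X n (Suc k) h * indicator {i. x i \<noteq> z i} (Suc k)"
    proof (cases "x (Suc k) = z (Suc k)")
      case True
      then have "w k = w (Suc k)"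
        by (auto simp: w_def le_Suc_eq)
      then show ?thesis
        using True by simp
    next
      case False
      have "\<bar>h (w k) - h (w (Suc k))\<bar> \<le> osc X n (Suc k) h"
        by (rule abs_diff_le_osc[OF h w w]) (auto simp: w_def le_Suc_eq)
      then show ?thesis
        using False by simp
    qed
    then show ?case
      using Suc by simp
  qed simp
  from this[of n] show ?thesis
    by (simp only: w_0 w_n)
qed

text \<open>
  Measurability of the diagonal enters here: the event is the preimage of the complement of the
  diagonal under the measurable map that takes a pair of paths to their \<open>j\<close>-th coordinates.
\<close>

lemma sets_differing_coordinate:
  assumes diagonal: "{(a, b). a \<in> space X \<and> b \<in> space X \<and> a = b} \<in> sets (X \<Otimes>\<^sub>M X)"
    and j: "j \<in> {1..n}"
  shows "{w \<in> space (path_space X n \<Otimes>\<^sub>M path_space X n). fst w j \<noteq> snd w j}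
    \<in> sets (path_space X n \<Otimes>\<^sub>M path_space X n)"
proof -
  let ?S = "path_space X n" and ?d = "{(a, b). a \<in> space X \<and> b \<in> space X \<and> a = b}"
  have coord: "(\<lambda>w. (fst w j, snd w j)) \<in> ?S \<Otimes>\<^sub>M ?S \<rightarrow>\<^sub>M X \<Otimes>\<^sub>M X"
    using j by measurable
  have "(\<lambda>w. (fst w j, snd w j)) -` (space (X \<Otimes>\<^sub>M X) - ?d) \<inter> space (?S \<Otimes>\<^sub>M ?S)
      \<in> sets (?S \<Otimes>\<^sub>M ?S)"
    using diagonal by (intro measurable_sets[OF coord] sets.compl_sets)
  also have "(\<lambda>w. (fst w j, snd w j)) -` (space (X \<Otimes>\<^sub>M X) - ?d) \<inter> space (?S \<Otimes>\<^sub>M ?S)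
      = {w \<in> space (?S \<Otimes>\<^sub>M ?S). fst w j \<noteq> snd w j}"
    using j by (auto simp: space_pair_measure space_PiM PiE_iff)
  finally show ?thesis .
qed

lemma coupling_integral_bound:
  assumes coupling: "coupling (path_space X n) \<mu> \<nu> \<Psi>"
    and diagonal: "{(a, b). a \<in> space X \<and> b \<in> space X \<and> a = b} \<in> sets (X \<Otimes>\<^sub>M X)"
    and h: "h \<in> borel_measurable (path_space X n)" "finite_oscillation (path_space X n) h"
  shows "\<bar>(\<integral>x. h x \<partial>\<mu>) - (\<integral>x. h x \<partial>\<nu>)\<bar>
    \<le> (\<Sum>j\<in>{1..n}. osc X n j h * measure \<Psi> {w \<in> space \<Psi>. fst w j \<noteq> snd w j})"
proof -
  let ?S = "path_space X n" and ?N = "\<lambda>j. {w \<in> space \<Psi>. fst w j \<noteq> snd w j}"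
  have sets_\<Psi> [measurable_cong]: "sets \<Psi> = sets (?S \<Otimes>\<^sub>M ?S)"
    and space_\<Psi>: "space \<Psi> = space (?S \<Otimes>\<^sub>M ?S)" and prob: "prob_space \<Psi>"
    and \<mu>: "\<mu> = distr \<Psi> ?S fst" and \<nu>: "\<nu> = distr \<Psi> ?S snd"
    using coupling by (auto simp: coupling_def space_prob_algebra dest: sets_eq_imp_space_eq)
  interpret prob_space \<Psi>
    by (rule prob)
  note h(1) [measurable]
  obtain B where B: "\<forall>x\<in>space ?S. \<bar>h x\<bar> \<le> B"
    using h(2) unfolding finite_oscillation_iff_bounded by blast
  have in_S: "fst w \<in> space ?S" "snd w \<in> space ?S" if "w \<in> space \<Psi>" for w
    using that by (auto simp: space_\<Psi> space_pair_measure)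
  have fst_snd: "fst \<in> \<Psi> \<rightarrow>\<^sub>M ?S" "snd \<in> \<Psi> \<rightarrow>\<^sub>M ?S"
    by measurable
  have int_fst: "integrable \<Psi> (\<lambda>w. h (fst w))"
    using B in_S by (intro integrable_const_bound[where B = B] AE_I2) auto
  have int_snd: "integrable \<Psi> (\<lambda>w. h (snd w))"
    using B in_S by (intro integrable_const_bound[where B = B] AE_I2) auto
  have N: "?N j \<in> sets \<Psi>" if "j \<in> {1..n}" for j
    using sets_differing_coordinate[OF diagonal that] unfolding sets_\<Psi> space_\<Psi> .
  have int_N: "integrable \<Psi> (\<lambda>w. osc X n j h * indicator (?N j) w)" if "j \<in> {1..n}" for j
    using N[OF that] by (intro integrable_mult_right integrable_real_indicator) (auto simp: emeasure_eq_measure)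
  have "(\<integral>x. h x \<partial>\<mu>) - (\<integral>x. h x \<partial>\<nu>) = (\<integral>w. h (fst w) - h (snd w) \<partial>\<Psi>)"
    unfolding \<mu> \<nu> integral_distr[OF fst_snd(1) h(1)] integral_distr[OF fst_snd(2) h(1)]
    using int_fst int_snd by simp
  also have "\<bar>\<dots>\<bar> \<le> (\<integral>w. (\<Sum>j\<in>{1..n}. osc X n j h * indicator (?N j) w) \<partial>\<Psi>)"
  proof (rule order_trans[OF integral_abs_bound integral_mono])
    fix w assume w: "w \<in> space \<Psi>"
    have "\<bar>h (fst w) - h (snd w)\<bar> \<le> (\<Sum>j\<in>{1..n}. osc X n j h * indicator {i. fst w i \<noteq> snd w i} j)"
      using abs_diff_le_sum_osc[OF h(2) in_S[OF w]] .
    also have "\<dots> = (\<Sum>j\<in>{1..n}. osc X n j h * indicator (?N j) w)"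
      using w by (intro sum.cong) (auto simp: indicator_def)
    finally show "\<bar>h (fst w) - h (snd w)\<bar> \<le> (\<Sum>j\<in>{1..n}. osc X n j h * indicator (?N j) w)" .
  qed (intro integrable_abs Bochner_Integration.integrable_diff Bochner_Integration.integrable_sum
      int_fst int_snd int_N; assumption)+
  also have "\<dots> = (\<Sum>j\<in>{1..n}. \<integral>w. osc X n j h * indicator (?N j) w \<partial>\<Psi>)"
    by (rule Bochner_Integration.integral_sum) (rule int_N)
  also have "\<dots> = (\<Sum>j\<in>{1..n}. osc X n j h * measure \<Psi> (?N j))"
    using N by (intro sum.cong) (auto simp: Int_absorb2 sets.sets_into_space)
  finally show ?thesis .
qed

text \<open>
  Combining the coupling bound with a Wasserstein matrix of the kernel leaves only the row sums of
  the matrix: the oscillations and the probabilities enter through a sum and a maximum.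
\<close>

lemma wasserstein_coupling_bound:
  assumes P: "P \<in> path_space X n \<rightarrow>\<^sub>M prob_algebra (path_space X n)"
    and A: "wasserstein_matrix X n P A"
    and rows: "\<And>i. i \<in> {1..n} \<Longrightarrow> mat_vec n A (\<lambda>_. 1) i \<le> r"
    and coupling: "coupling (path_space X n) \<mu> \<nu> \<Psi>"
    and diagonal: "{(a, b). a \<in> space X \<and> b \<in> space X \<and> a = b} \<in> sets (X \<Otimes>\<^sub>M X)"
    and f: "f \<in> borel_measurable (path_space X n)" "finite_oscillation (path_space X n) f"
  shows "\<bar>(\<integral>x. kernel_apply P f x \<partial>\<mu>) - (\<integral>x. kernel_apply P f x \<partial>\<nu>)\<bar>
    \<le> r * max_over {1..n} (\<lambda>j. measure \<Psi> {w \<in> space \<Psi>. fst w j \<noteq> snd w j})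
        * (\<Sum>i\<in>{1..n}. osc X n i f)"
proof -
  define p where "p j = measure \<Psi> {w \<in> space \<Psi>. fst w j \<noteq> snd w j}" for j
  define M where "M = max_over {1..n} p"
  have p: "0 \<le> p j" and p_M: "j \<in> {1..n} \<Longrightarrow> p j \<le> M" for j
    unfolding M_def using max_over_ge[of "{1..n}" j p] by (simp_all add: p_def)
  have M: "0 \<le> M"
  proof (cases "n = 0")
    case False
    then show ?thesis
      using order_trans[OF p p_M[of n]] by simp
  qed (simp add: M_def max_over_def)
  have S: "space (path_space X n) \<noteq> {}"
  proof -
    have "prob_space \<Psi>" "space \<Psi> = space (path_space X n \<Otimes>\<^sub>M path_space X n)"
      using coupling by (auto simp: coupling_def space_prob_algebra dest: sets_eq_imp_space_eq)
    then show ?thesis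
      using prob_space.not_empty[of \<Psi>] by (auto simp: space_pair_measure)
  qed
  have "\<bar>(\<integral>x. kernel_apply P f x \<partial>\<mu>) - (\<integral>x. kernel_apply P f x \<partial>\<nu>)\<bar>
      \<le> (\<Sum>j\<in>{1..n}. osc X n j (kernel_apply P f) * p j)"
    unfolding p_def
    by (intro coupling_integral_bound coupling diagonal measurable_kernel_apply
        finite_oscillation_kernel_apply P f)
  also have "\<dots> \<le> (\<Sum>j\<in>{1..n}. (\<Sum>i\<in>{1..n}. osc X n i f * A i j) * p j)"
    using wasserstein_matrixD(2)[OF A f] p by (intro sum_mono mult_right_mono) auto
  also have "\<dots> = (\<Sum>j\<in>{1..n}. \<Sum>i\<in>{1..n}. osc X n i f * (A i j * p j))"
    by (simp add: sum_distrib_right mult.assoc)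
  also have "\<dots> = (\<Sum>i\<in>{1..n}. \<Sum>j\<in>{1..n}. osc X n i f * (A i j * p j))"
    by (rule sum.swap)
  also have "\<dots> = (\<Sum>i\<in>{1..n}. osc X n i f * (\<Sum>j\<in>{1..n}. A i j * p j))"
    by (simp add: sum_distrib_left)
  also have "\<dots> \<le> (\<Sum>i\<in>{1..n}. osc X n i f * (r * M))"
  proof (intro sum_mono mult_left_mono osc_nonneg f S)
    fix i assume i: "i \<in> {1..n}"
    have "(\<Sum>j\<in>{1..n}. A i j * p j) \<le> (\<Sum>j\<in>{1..n}. A i j * M)"
      using wasserstein_matrixD(1)[OF A i] p_M by (intro sum_mono mult_left_mono) auto
    also have "\<dots> = mat_vec n A (\<lambda>_. 1) i * M"
      by (simp add: mat_vec_def sum_distrib_right)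
    also have "\<dots> \<le> r * M"
      using rows[OF i] M by (rule mult_right_mono)
    finally show "(\<Sum>j\<in>{1..n}. A i j * p j) \<le> r * M" .
  qed
  also have "\<dots> = r * M * (\<Sum>i\<in>{1..n}. osc X n i f)"
    by (simp add: sum_distrib_left mult.commute)
  finally show ?thesis
    unfolding M_def p_def .
qed


section \<open>Convergence of the blocked Gibbs sampler\<close>

theorem corollary5:
  fixes X :: "'a measure" and Y :: "'b measure"
    and mu0 :: "'a \<Rightarrow> real" and m :: "'a \<Rightarrow> 'a \<Rightarrow> real" and g :: "'a \<Rightarrow> 'b \<Rightarrow> real"
    and n k :: nat and y :: "nat \<Rightarrow> 'b"
    and Js :: "nat set list"
    and \<kappa> :: "nat set \<Rightarrow> (nat \<Rightarrow> 'a) \<Rightarrow> (nat \<Rightarrow> 'a) measure"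
    and W :: "nat set \<Rightarrow> nat \<Rightarrow> nat \<Rightarrow> real"
    and lam :: real
    and \<mu> \<nu> :: "(nat \<Rightarrow> 'a) measure"
    and \<Psi> :: "((nat \<Rightarrow> 'a) \<times> (nat \<Rightarrow> 'a)) measure"
    and f :: "(nat \<Rightarrow> 'a) \<Rightarrow> real"
  defines "S \<equiv> path_space X n"
    and "P \<equiv> \<lambda>J. gibbs_kernel X n J (\<kappa> J)"
  defines "Pall \<equiv> kernel_prod S (map P Js)"
    and "Wall \<equiv> mat_prod n (map W (rev Js))"
    and "D \<equiv> (\<Union>J\<in>set Js. boundary n J)"
  assumes hmm: "hidden_markov_model X Y mu0 m g"
    and diagonal: "{(a, b). a \<in> space X \<and> b \<in> space X \<and> a = b} \<in> sets (X \<Otimes>\<^sub>M X)"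
    and n: "n \<ge> 1"
    and obs: "\<forall>t\<in>{1..n}. y t \<in> space Y"
    and evidence: "0 < evidence X n mu0 m g y" "evidence X n mu0 m g y < \<infinity>"
    and cover: "\<Union>(set Js) = {1..n}"
    and conditional: "\<forall>J\<in>set Js. block_conditional X n (smoothing X n mu0 m g y) J (\<kappa> J)"
    and wasserstein: "\<forall>J\<in>set Js. wasserstein_matrix X n (P J) (W J)"
    and W_outside: "\<forall>J\<in>set Js. \<forall>i\<in>{1..n} - J. \<forall>j\<in>{1..n}. W J i j = (if i = j then 1 else 0)"
    and W_inside: "\<forall>J\<in>set Js. \<forall>i\<in>J. \<forall>j\<in>{1..n} - boundary n J. W J i j = 0"
    and W_boundary: "\<forall>J\<in>set Js. \<forall>i\<in>J. \<forall>j\<in>boundary n J. W J i j \<in> {0..1}"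
    and lam: "lam < 1"
    and contraction:
      "\<forall>J\<in>set Js. max_over (J \<inter> D) (\<lambda>i. \<Sum>j\<in>boundary n J. W J i j) \<le> lam"
    and \<mu>: "\<mu> \<in> space (prob_algebra S)"
    and \<nu>: "\<nu> \<in> space (prob_algebra S)"
    and coupling: "coupling S \<mu> \<nu> \<Psi>"
    and k: "k \<ge> 1"
    and f: "f \<in> borel_measurable S" "finite_oscillation S f"
  shows "\<bar>(\<integral>x. kernel_apply (kernel_power S Pall k) f x \<partial>\<mu>)
          - (\<integral>x. kernel_apply (kernel_power S Pall k) f x \<partial>\<nu>)\<bar>
         \<le> mat_norm_inf n Wall * lam ^ (k - 1)
            * max_over {1..n} (\<lambda>j. measure \<Psi> {w \<in> space \<Psi>. fst w j \<noteq> snd w j})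
            * (\<Sum>i\<in>{1..n}. osc X n i f)"
proof -
  have J_subset: "J \<subseteq> {1..n}" if "J \<in> set Js" for J
    using cover that by blast
  have finite_J: "finite (J \<inter> D)" if "J \<in> set Js" for J
    using J_subset[OF that] finite_subset by blast
  interpret block_matrices n Js W D lam
  proof
    show "D \<subseteq> {1..n}"
      by (auto simp: D_def boundary_def)
    fix J i assume J: "J \<in> set Js" and i: "i \<in> J \<inter> D"
    have "(\<Sum>j\<in>boundary n J. W J i j)
        \<le> max_over (J \<inter> D) (\<lambda>i. \<Sum>j\<in>boundary n J. W J i j)"
      by (rule max_over_ge[OF finite_J[OF J] i])
    then show "(\<Sum>j\<in>boundary n J. W J i j) \<le> lam"
      using contraction J by fastforce
  qed (use cover W_outside W_inside W_boundary in \<open>auto simp: D_def\<close>)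
  \<comment> \<open>Some block exists since \<open>n \<ge> 1\<close>; its constraint bounds \<open>\<lambda>\<close> below by a maximum of nonnegative
    row sums, or by \<open>0\<close> if the block contains no boundary site.\<close>
  have "0 \<le> lam"
  proof -
    obtain J where J: "J \<in> set Js"
      using cover n by fastforce
    have "0 \<le> max_over (J \<inter> D) (\<lambda>i. \<Sum>j\<in>boundary n J. W J i j)"
    proof (cases "J \<inter> D = {}")
      case False
      then obtain i where i: "i \<in> J \<inter> D"
        by blast
      have "0 \<le> (\<Sum>j\<in>boundary n J. W J i j)"
        using W_boundary J i by (intro sum_nonneg) auto
      also have "\<dots> \<le> max_over (J \<inter> D) (\<lambda>i. \<Sum>j\<in>boundary n J. W J i j)"
        by (rule max_over_ge[OF finite_J[OF J] i])
      finally show ?thesis .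
    qed (simp add: max_over_def)
    then show ?thesis
      using contraction J by fastforce
  qed
  have "P J \<in> S \<rightarrow>\<^sub>M prob_algebra S" if "J \<in> set Js" for J
    unfolding P_def S_def using conditional that J_subset
    by (intro measurable_gibbs_kernel) (auto simp: block_conditional_def)
  then have blocks: "list_all2 (\<lambda>P A. P \<in> S \<rightarrow>\<^sub>M prob_algebra S \<and> wasserstein_matrix X n P A)
      (map P Js) (map W Js)"
    using wasserstein by (simp add: list_all2_map1 list_all2_map2 list_all2_same)
  have Pall: "Pall \<in> S \<rightarrow>\<^sub>M prob_algebra S" "wasserstein_matrix X n Pall Wall"
    using wasserstein_matrix_kernel_prod[OF blocks[unfolded S_def]]
    unfolding Pall_def Wall_def S_def by (simp_all add: rev_map)
  then have "list_all2 (\<lambda>P A. P \<in> S \<rightarrow>\<^sub>M prob_algebra S \<and> wasserstein_matrix X n P A)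
      (replicate k Pall) (replicate k Wall)"
    by (simp add: list_all2_conv_all_nth)
  note power = wasserstein_matrix_kernel_prod[OF this[unfolded S_def], folded S_def kernel_power_def]
  have rows: "mat_vec n (mat_prod n (rev (replicate k Wall))) (\<lambda>_. 1) i
      \<le> mat_norm_inf n Wall * lam ^ (k - 1)" if "i \<in> {1..n}" for i
    using iterated_sweep_row_sum[OF \<open>0 \<le> lam\<close> less_imp_le[OF lam] that, of "k - 1"] k
    by (simp add: Wall_def)
  show ?thesis
    using wasserstein_coupling_bound[OF power[unfolded S_def] rows coupling[unfolded S_def] diagonal
        f[unfolded S_def]]
    unfolding S_def .
qed

end
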